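(* Let $G_1$ and $G_2$ be two simple graphs and let $\mathbb{F}$ be a class of graphs closed under isomorphism. If $\theta$ is a graph homomorphism from $G_1$ to $G_2$ such that the preimage under $\theta$ of each subgraph in $\mathbb{F}(G_2)$ is a subgraph in $\mathbb{F}(G_1)$, then $$\mathbb{F}\text{-cover}_{\mathrm{f}}(G_1)\leq \mathbb{F}\text{-cover}_{\mathrm{f}}(G_2).$$
   Context: All graphs are finite and simple (no loops or multiple edges). For a class $\mathbb{F}$ of graphs closed under isomorphism and a graph $G$, $\mathbb{F}(G)$ denotes the set of induced subgraphs of $G$ belonging to $\mathbb{F}$, and for $v\in V(G)$, $\mathbb{F}(G,v)$ denotes the set of those elements of $\mathbb{F}(G)$ that contain $v$. A fractional $\mathbb{F}$-cover of $G$ is a function $f:\mathbb{F}(G)\to[0,1]$ such that $\sum_{H\in\mathbb{F}(G,v)}f(H)\geq 1$ for every $v\in V(G)$. Its weight is $\sum_{H\in\mathbb{F}(G)}f(H)$. The fractional $\mathbb{F}$-cover number of $G$, denoted $\mathbb{F}\text{-cover}_{\mathrm{f}}(G)$, is the minimum weight over all fractional $\mathbb{F}$-covers of $G$ (with the convention that it is $+\infty$ if no fractional $\mathbb{F}$-cover of $G$ exists). For a homomorphism $\theta$ from $G_1$ to $G_2$ (a map $V(G_1)\to V(G_2)$ sending adjacent vertices to adjacent vertices) and an induced subgraph $H$ of $G_2$, the preimage of $H$ under $\theta$ is the subgraph of $G_1$ induced by $\{u\in V(G_1):\theta(u)\in V(H)\}$. *)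

theory Defs
  imports
    "HOL-Analysis.Function_Topology"
    "Graph_Theory.Pair_Digraph"
    "Graph_Theory.Digraph_Isomorphism"
begin

text \<open>
  A finite simple graph is a \<^locale>\<open>pair_graph\<close>: its arcs form a finite, symmetric, irreflexive
  relation on its finite vertex set. The null graph is allowed. All graphs have their vertices in
  a common type \<^typ>\<open>'a\<close>, so that a class of graphs is a set of graphs on \<^typ>\<open>'a\<close>.
\<close>

definition iso_closed_class :: "'a pair_pre_digraph set \<Rightarrow> bool" where
  "iso_closed_class F \<longleftrightarrow>
     (\<forall>H\<in>F. pair_graph H) \<and>
     (\<forall>H\<in>F. \<forall>H'. digraph_iso (with_proj H) (with_proj H') \<longrightarrow> H' \<in> F)"

definition class_subgraphs ::
  "'a pair_pre_digraph set \<Rightarrow> 'a pair_pre_digraph \<Rightarrow> 'a pair_pre_digraph set" where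
  "class_subgraphs F G = {H \<in> F. induced_subgraph (with_proj H) (with_proj G)}"

definition class_subgraphs_at ::
  "'a pair_pre_digraph set \<Rightarrow> 'a pair_pre_digraph \<Rightarrow> 'a \<Rightarrow> 'a pair_pre_digraph set" where
  "class_subgraphs_at F G v = {H \<in> class_subgraphs F G. v \<in> pverts H}"

text \<open>Only the values of a cover on \<^term>\<open>class_subgraphs F G\<close> are relevant.\<close>

definition fractional_cover ::
  "'a pair_pre_digraph set \<Rightarrow> 'a pair_pre_digraph \<Rightarrow> ('a pair_pre_digraph \<Rightarrow> real) \<Rightarrow> bool" where
  "fractional_cover F G f \<longleftrightarrow>
     f \<in> class_subgraphs F G \<rightarrow> {0..1} \<and>
     (\<forall>v\<in>pverts G. (\<Sum>H\<in>class_subgraphs_at F G v. f H) \<ge> 1)"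

definition cover_weight ::
  "'a pair_pre_digraph set \<Rightarrow> 'a pair_pre_digraph \<Rightarrow> ('a pair_pre_digraph \<Rightarrow> real) \<Rightarrow> real" where
  "cover_weight F G f = (\<Sum>H\<in>class_subgraphs F G. f H)"

text \<open>
  The infimum of the empty set is \<^term>\<open>\<infinity> :: ereal\<close>; otherwise the infimum is a minimum, see
  \<open>fractional_cover_number_attained\<close> below.
\<close>

definition fractional_cover_number ::
  "'a pair_pre_digraph set \<Rightarrow> 'a pair_pre_digraph \<Rightarrow> ereal" where
  "fractional_cover_number F G = (INF f\<in>{f. fractional_cover F G f}. ereal (cover_weight F G f))"

definition graph_hom ::
  "'a pair_pre_digraph \<Rightarrow> 'b pair_pre_digraph \<Rightarrow> ('a \<Rightarrow> 'b) \<Rightarrow> bool" where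
  "graph_hom G1 G2 \<theta> \<longleftrightarrow>
     \<theta> \<in> pverts G1 \<rightarrow> pverts G2 \<and>
     (\<forall>u v. (u, v) \<in> parcs G1 \<longrightarrow> (\<theta> u, \<theta> v) \<in> parcs G2)"

definition hom_preimage ::
  "'a pair_pre_digraph \<Rightarrow> ('a \<Rightarrow> 'b) \<Rightarrow> 'b pair_pre_digraph \<Rightarrow> 'a pair_pre_digraph" where
  "hom_preimage G1 \<theta> H =
     (let U = {u \<in> pverts G1. \<theta> u \<in> pverts H}
      in \<lparr>pverts = U, parcs = {e \<in> parcs G1. fst e \<in> U \<and> snd e \<in> U}\<rparr>)"

lemma with_proj_hom_preimage:
  "with_proj (hom_preimage G1 \<theta> H) = with_proj G1 \<restriction> {u \<in> pverts G1. \<theta> u \<in> pverts H}"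
  by (simp add: hom_preimage_def with_proj_def induce_subgraph_def)

lemma digraph_iso_with_proj_iff:
  assumes "pair_graph G"
  shows "digraph_iso (with_proj G) (with_proj H) \<longleftrightarrow>
    (\<exists>h. bij_betw h (pverts G) (pverts H) \<and> parcs H = map_prod h h ` parcs G)"
    (is "_ \<longleftrightarrow> ?iso")
proof
  assume "digraph_iso (with_proj G) (with_proj H)"
  then obtain f where f: "pre_digraph.digraph_isomorphism (with_proj G) f"
    and H: "with_proj H = app_iso f (with_proj G)"
    unfolding digraph_iso_def by blast
  have ends: "iso_tail f = fst" "iso_head f = snd"
    using arg_cong[OF H, of tail] arg_cong[OF H, of head] by simp_all
  have "iso_arcs f e = map_prod (iso_verts f) (iso_verts f) e" if "e \<in> parcs G" for e
    using f that unfolding pre_digraph.digraph_isomorphism_def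
    by (simp add: ends prod_eq_iff)
  then have "parcs H = map_prod (iso_verts f) (iso_verts f) ` parcs G"
    using arg_cong[OF H, of arcs] by simp
  moreover have "bij_betw (iso_verts f) (pverts G) (pverts H)"
    using f arg_cong[OF H, of verts]
    by (simp add: pre_digraph.digraph_isomorphism_def bij_betw_def)
  ultimately show ?iso by blast
next
  assume ?iso
  then obtain h where h: "bij_betw h (pverts G) (pverts H)" "parcs H = map_prod h h ` parcs G"
    by (elim exE conjE)
  define f where "f = \<lparr>iso_verts = h, iso_arcs = map_prod h h, iso_head = snd, iso_tail = fst\<rparr>"
  have pwf: "pair_wf_digraph G"
    using assms by (simp add: pair_graph_def pair_digraph_def pair_fin_digraph_def)
  then have "parcs G \<subseteq> pverts G \<times> pverts G"
    by (metis mem_Times_iff pair_wf_digraph_def subsetI)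
  moreover have inj: "inj_on h (pverts G)"
    using h(1) by (rule bij_betw_imp_inj_on)
  ultimately have "inj_on (map_prod h h) (parcs G)"
    using inj_on_subset map_prod_inj_on by metis
  then have "pre_digraph.digraph_isomorphism (with_proj G) f"
    using inj pwf by (simp add: pre_digraph.digraph_isomorphism_def f_def wf_digraph_wp_iff)
  moreover have "with_proj H = app_iso f (with_proj G)"
    using h by (simp add: with_proj_def app_iso_def f_def bij_betw_def)
  ultimately show "digraph_iso (with_proj G) (with_proj H)"
    unfolding digraph_iso_def by (intro exI conjI)
qed

lemma finite_class_subgraphs:
  assumes "pair_graph G"
  shows "finite (class_subgraphs F G)"
proof -
  interpret pair_graph G by fact
  have "class_subgraphs F G \<subseteq>
    (\<lambda>(V, A). \<lparr>pverts = V, parcs = A\<rparr>) ` (Pow (pverts G) \<times> Pow (parcs G))"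
  proof
    fix H assume "H \<in> class_subgraphs F G"
    then have "pverts H \<subseteq> pverts G" "parcs H \<subseteq> parcs G"
      by (auto simp: class_subgraphs_def induced_subgraph_def subgraph_def)
    then show "H \<in> (\<lambda>(V, A). \<lparr>pverts = V, parcs = A\<rparr>) ` (Pow (pverts G) \<times> Pow (parcs G))"
      by (intro image_eqI[of _ _ "(pverts H, parcs H)"]) auto
  qed
  then show ?thesis
    by (rule finite_subset) (simp add: pair_finite_verts pair_finite_arcs)
qed

lemma fractional_cover_number_attained:
  assumes "fractional_cover F G f0"
  obtains f where "fractional_cover F G f"
    and "fractional_cover_number F G = ereal (cover_weight F G f)"
    and "\<And>g. fractional_cover F G g \<Longrightarrow> cover_weight F G f \<le> cover_weight F G g"
proof -
  let ?C = "class_subgraphs F G"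
  have cont: "continuous_on UNIV (\<lambda>f :: 'a pair_pre_digraph \<Rightarrow> real. \<Sum>H\<in>A. f H)" for A
    by (intro continuous_on_sum continuous_on_product_coordinates)
  define K where "K = {f :: 'a pair_pre_digraph \<Rightarrow> real. \<forall>H. f H \<in> {0..1}}"
  define L where "L = {f :: 'a pair_pre_digraph \<Rightarrow> real.
    \<forall>v\<in>pverts G. 1 \<le> (\<Sum>H\<in>class_subgraphs_at F G v. f H)}"
  define cut where "cut f H = (if H \<in> ?C then f H else 0)"
    for f :: "'a pair_pre_digraph \<Rightarrow> real" and H
  have "compactin (product_topology (\<lambda>_. euclidean) UNIV)
      (PiE UNIV (\<lambda>_ :: 'a pair_pre_digraph. {0..1 :: real}))"
    unfolding compactin_PiE by simp
  moreover have "PiE UNIV (\<lambda>_. {0..1}) = K"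
    by (auto simp: K_def PiE_def extensional_def Pi_def)
  ultimately have "compact K" by (simp add: euclidean_product_topology)
  moreover have "closed L"
    unfolding L_def Ball_def
    by (intro closed_Collect_all closed_Collect_imp open_Collect_const closed_Collect_le
        continuous_on_const cont)
  ultimately have comp: "compact (K \<inter> L)" by (rule compact_Int_closed)
  have cut: "cut f \<in> K \<inter> L" "cover_weight F G (cut f) = cover_weight F G f"
    if "fractional_cover F G f" for f
  proof -
    have "(\<Sum>H\<in>class_subgraphs_at F G v. cut f H) = (\<Sum>H\<in>class_subgraphs_at F G v. f H)" for v
      by (rule sum.cong) (auto simp: cut_def class_subgraphs_at_def)
    then show "cut f \<in> K \<inter> L"
      using that by (auto simp: K_def L_def fractional_cover_def cut_def Pi_iff)
    show "cover_weight F G (cut f) = cover_weight F G f"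
      by (simp add: cover_weight_def cut_def)
  qed
  have cw: "continuous_on (K \<inter> L) (cover_weight F G)"
    unfolding cover_weight_def by (rule continuous_on_subset[OF cont]) simp
  have "\<exists>f\<in>K \<inter> L. \<forall>g\<in>K \<inter> L. cover_weight F G f \<le> cover_weight F G g"
    by (rule continuous_attains_inf[OF comp _ cw]) (use cut(1)[OF assms] in blast)
  then obtain f where f: "f \<in> K \<inter> L"
    and le: "\<And>g. g \<in> K \<inter> L \<Longrightarrow> cover_weight F G f \<le> cover_weight F G g"
    by blast
  have cov: "fractional_cover F G f"
    using f by (auto simp: K_def L_def fractional_cover_def)
  have min: "cover_weight F G f \<le> cover_weight F G g" if "fractional_cover F G g" for g
    using le[OF cut(1)[OF that]] cut(2)[OF that] by simp
  have "fractional_cover_number F G = ereal (cover_weight F G f)"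
    unfolding fractional_cover_number_def
  proof (rule antisym)
    show "(INF f\<in>{f. fractional_cover F G f}. ereal (cover_weight F G f))
        \<le> ereal (cover_weight F G f)"
      by (rule INF_lower) (simp add: cov)
    show "ereal (cover_weight F G f)
        \<le> (INF f\<in>{f. fractional_cover F G f}. ereal (cover_weight F G f))"
      by (rule INF_greatest) (simp add: min)
  qed
  then show ?thesis using that cov min by blast
qed

lemma fractional_cover_number_eq_infinity:
  assumes "\<nexists>f. fractional_cover F G f"
  shows "fractional_cover_number F G = \<infinity>"
  using assms by (simp add: fractional_cover_number_def top_ereal_def)

end

theory Submission
  imports Defs
begin

text \<open>
  Push a fractional cover of \<open>G2\<close> forward along \<open>H \<mapsto> \<theta>\<^sup>-\<^sup>1(H)\<close>. Distinct \<open>H\<close> may have the same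
  preimage, so the sum over a fibre can exceed 1 and is truncated at 1. Truncation only lowers
  the weight, and it preserves the covering condition because a truncated summand alone is
  already 1.
\<close>

lemma pverts_hom_preimage: "pverts (hom_preimage G \<theta> H) = {u \<in> pverts G. \<theta> u \<in> pverts H}"
  by (simp add: hom_preimage_def Let_def)

text \<open>If some \<open>s x\<close> reaches 1, its truncation alone gives 1 and the other terms
  are nonnegative; otherwise no term is changed.\<close>

lemma one_le_sum_min_one:
  fixes s :: "'b \<Rightarrow> real"
  assumes "finite A" and nonneg: "\<And>x. x \<in> A \<Longrightarrow> 0 \<le> s x" and "1 \<le> sum s A"
  shows "1 \<le> (\<Sum>x\<in>A. min 1 (s x))"
proof (cases "\<exists>x\<in>A. 1 \<le> s x")
  case True
  then obtain x where x: "x \<in> A" "1 \<le> s x" by blast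
  have "min 1 (s x) \<le> (\<Sum>x\<in>A. min 1 (s x))"
    using assms(1) nonneg x(1) by (intro member_le_sum) auto
  with x(2) show ?thesis by simp
next
  case False
  then have "(\<Sum>x\<in>A. min 1 (s x)) = sum s A"
    by (intro sum.cong) auto
  with assms(3) show ?thesis by simp
qed

lemma fractional_cover_hom_preimage:
  fixes G1 :: "'a pair_pre_digraph" and G2 :: "'b pair_pre_digraph"
  assumes "pair_graph G1" and "pair_graph G2"
    and vert: "\<theta> \<in> pverts G1 \<rightarrow> pverts G2"
    and preim: "\<And>H. H \<in> class_subgraphs F2 G2 \<Longrightarrow> hom_preimage G1 \<theta> H \<in> class_subgraphs F1 G1"
    and cover: "fractional_cover F2 G2 f"
  obtains g where "fractional_cover F1 G1 g" and "cover_weight F1 G1 g \<le> cover_weight F2 G2 f"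
proof -
  let ?C1 = "class_subgraphs F1 G1" and ?C2 = "class_subgraphs F2 G2"
  \<comment> \<open>The weight of the fibre over \<open>K\<close>; it is 0 when \<open>K\<close> is
    not a preimage.\<close>
  define s where "s K = (\<Sum>H\<in>{H \<in> ?C2. hom_preimage G1 \<theta> H = K}. f H)" for K
  define g where "g K = min 1 (s K)" for K
  have fin: "finite ?C1" "finite ?C2"
    using assms(1,2) by (simp_all add: finite_class_subgraphs)
  have s0: "0 \<le> s K" for K
    unfolding s_def using cover by (intro sum_nonneg) (auto simp: fractional_cover_def)
  have "1 \<le> (\<Sum>K\<in>class_subgraphs_at F1 G1 v. g K)" if v: "v \<in> pverts G1" for v
    unfolding g_def
  proof (rule one_le_sum_min_one)
    show finv: "finite (class_subgraphs_at F1 G1 v)"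
      using fin(1) by (simp add: class_subgraphs_at_def)
    \<comment> \<open>Since \<open>v\<close> lies in the preimage of \<open>H\<close> iff
      \<open>\<theta> v\<close> lies in \<open>H\<close>, the fibre over a \<open>K\<close>
      containing \<open>v\<close> consists only of subgraphs through
      \<open>\<theta> v\<close>.\<close>
    have "(\<Sum>K\<in>class_subgraphs_at F1 G1 v. s K) =
        (\<Sum>K\<in>class_subgraphs_at F1 G1 v.
          \<Sum>H\<in>{H \<in> class_subgraphs_at F2 G2 (\<theta> v). hom_preimage G1 \<theta> H = K}. f H)"
      unfolding s_def using v
      by (intro sum.cong) (auto simp: class_subgraphs_at_def pverts_hom_preimage)
    \<comment> \<open>By \<open>preim\<close>, these fibres partition the subgraphs through
      \<open>\<theta> v\<close>.\<close>
    also have "\<dots> = (\<Sum>H\<in>class_subgraphs_at F2 G2 (\<theta> v). f H)"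
      using v fin(2) finv preim
      by (intro sum.group) (auto simp: class_subgraphs_at_def pverts_hom_preimage)
    also have "1 \<le> \<dots>"
      using cover vert v by (auto simp: fractional_cover_def)
    finally show "1 \<le> (\<Sum>K\<in>class_subgraphs_at F1 G1 v. s K)" .
  qed (rule s0)
  then have "fractional_cover F1 G1 g"
    using s0 by (auto simp: fractional_cover_def g_def)
  moreover have "cover_weight F1 G1 g \<le> cover_weight F2 G2 f"
  proof -
    have "(\<Sum>K\<in>?C1. g K) \<le> (\<Sum>K\<in>?C1. s K)"
      by (intro sum_mono) (simp add: g_def)
    \<comment> \<open>Each \<open>H\<close> lies in exactly one fibre over \<open>?C1\<close>, so
      before truncation the total weight is preserved.\<close>
    also have "\<dots> = (\<Sum>H\<in>?C2. f H)"
      unfolding s_def using fin preim by (intro sum.group) auto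
    finally show ?thesis by (simp add: cover_weight_def)
  qed
  ultimately show thesis by (rule that)
qed

theorem lemma2p1:
  fixes G1 G2 :: "'a pair_pre_digraph"
    and F :: "'a pair_pre_digraph set"
    and \<theta> :: "'a \<Rightarrow> 'a"
  assumes "pair_graph G1" and "pair_graph G2"
    and "iso_closed_class F"
    and "graph_hom G1 G2 \<theta>"
    and "\<forall>H \<in> class_subgraphs F G2. hom_preimage G1 \<theta> H \<in> class_subgraphs F G1"
  shows "fractional_cover_number F G1 \<le> fractional_cover_number F G2"
  unfolding fractional_cover_number_def
\<comment> \<open>Matching covers one by one also settles the case where \<open>G2\<close> has none:
  its infimum is then infinite.\<close>
proof (rule INF_mono)
  fix f assume "f \<in> {f. fractional_cover F G2 f}"
  moreover have "\<theta> \<in> pverts G1 \<rightarrow> pverts G2"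
    using assms(4) by (simp add: graph_hom_def)
  ultimately obtain g where "fractional_cover F G1 g" "cover_weight F G1 g \<le> cover_weight F G2 f"
    using fractional_cover_hom_preimage[OF assms(1,2), of \<theta> F F f] assms(5) by blast
  then show "\<exists>g\<in>{g. fractional_cover F G1 g}. ereal (cover_weight F G1 g) \<le> ereal (cover_weight F G2 f)"
    by auto
qed

end
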